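(* Let $H$ be an $m\times n$ parity-check matrix of a nonzero binary linear code $\mathcal{C}$, and assume that the first $m-1$ rows of $H$ have weight $2$ (exactly two nonzero entries each). Denote by $\widehat{H}$ the $(m-1)\times n$ matrix consisting of these rows, let $\sim$ be the equivalence relation on the set $\mathcal{I}=\{1,\dots,n\}$ of column indices induced by $\widehat{H}$ (defined in the context), and assume that $\mathcal{I}_m=\{i\in\mathcal{I}: H_{m,i}\neq 0\}$ intersects each equivalence class of $\sim$ in at most one element. Then the minimum distance of $\mathcal{C}$ is equal to its minimum AWGNC pseudoweight, its minimum BSC pseudoweight and its minimum max-fractional weight with respect to $H$, i.e. $d(\mathcal{C})=w_{\mathrm{AWGNC}}^{\min}(H)=w_{\mathrm{BSC}}^{\min}(H)=w_{\mathrm{maxfrac}}^{\min}(H)$.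
   Context: A binary linear code of length $n$ is a linear subspace $\mathcal{C}\subseteq\mathbb{F}_2^n$; $d(\mathcal{C})$ is its minimum Hamming distance. A parity-check matrix of $\mathcal{C}$ is any $m\times n$ matrix $H$ over $\mathbb{F}_2$ (redundant rows allowed) with $\mathcal{C}=\ker H=\{c\in\mathbb{F}_2^n : Hc^T=0\}$. Put $\mathcal{I}=\{1,\dots,n\}$, $\mathcal{J}=\{1,\dots,m\}$, and $\mathcal{I}_j=\{i\in\mathcal{I}: H_{j,i}\ne 0\}$ for $j\in\mathcal{J}$. The fundamental cone $\mathcal{K}(H)$ is the set of $x\in\mathbb{R}^n$ with $x_i\ge 0$ for all $i\in\mathcal{I}$ and $x_\ell\le\sum_{i\in\mathcal{I}_j\setminus\{\ell\}}x_i$ for all $j\in\mathcal{J}$, $\ell\in\mathcal{I}_j$ (an empty sum is $0$). For nonzero $x\in\mathcal{K}(H)$ define: $w_{\mathrm{AWGNC}}(x)=\left(\sum_i x_i\right)^2/\sum_i x_i^2$; $w_{\mathrm{maxfrac}}(x)=\left(\sum_i x_i\right)/\max_i x_i$; and $w_{\mathrm{BSC}}(x)=2\,\Phi^{-1}(\Phi(n)/2)$, where $x'$ is $x$ with its components rearranged in non-increasing order, $\phi(\xi)=x'_i$ for $i-1<\xi\le i$ ($1\le i\le n$), and $\Phi(\xi)=\int_0^\xi\phi(\xi')\,d\xi'$ (i.e. $\Phi^{-1}(\Phi(n)/2)$ is the unique $\xi\in[0,n]$ with $\Phi(\xi)=\Phi(n)/2$). For each type of weight $w$, the minimum pseudoweight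 is $w^{\min}(H)=\min_{x\in\mathcal{K}(H)\setminus\{0\}}w(x)$. Equivalence relation induced by a matrix $\widehat{H}$ all of whose rows have weight $2$: $i\sim i'$ if and only if $i=i'$ or there exist $\ell\ge1$, column indices $i=i_0,i_1,\dots,i_\ell=i'$ and rows $j_1,\dots,j_\ell$ of $\widehat{H}$ such that $\{i_{s-1},i_s\}=\mathcal{I}_{j_s}$ for $s=1,\dots,\ell$. *)

theory Defs
  imports
    "HOL-Analysis.Analysis"
    "HOL-Library.Z2"
    "Jordan_Normal_Form.Matrix_Kernel"
begin

(* The bare vector notation below always refers to the dynamically sized vectors of
   Jordan_Normal_Form.Matrix. Rows and columns are indexed from 0. *)
no_notation Finite_Cartesian_Product.vec_nth (infixl \<open>$\<close> 90)

definition binary_linear_code :: "nat \<Rightarrow> bit vec set \<Rightarrow> bool" where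
  "binary_linear_code n C \<longleftrightarrow> VectorSpace.subspace class_ring C (module_vec TYPE(bit) n)"

definition parity_check_matrix :: "bit vec set \<Rightarrow> bit mat \<Rightarrow> bool" where
  "parity_check_matrix C H \<longleftrightarrow> C = mat_kernel H"

definition hamming_dist :: "bit vec \<Rightarrow> bit vec \<Rightarrow> nat" where
  "hamming_dist u v = card {i. i < dim_vec u \<and> u $ i \<noteq> v $ i}"

definition min_distance :: "bit vec set \<Rightarrow> nat" where
  "min_distance C = Min {hamming_dist u v | u v. u \<in> C \<and> v \<in> C \<and> u \<noteq> v}"

definition row_support :: "bit mat \<Rightarrow> nat \<Rightarrow> nat set" where
  "row_support H j = {i. i < dim_col H \<and> H $$ (j, i) \<noteq> 0}"

definition fundamental_cone :: "bit mat \<Rightarrow> real vec set" where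
  "fundamental_cone H = {x \<in> carrier_vec (dim_col H).
     (\<forall>i < dim_col H. 0 \<le> x $ i) \<and>
     (\<forall>j < dim_row H. \<forall>l \<in> row_support H j. x $ l \<le> (\<Sum>i \<in> row_support H j - {l}. x $ i))}"

definition w_AWGNC :: "real vec \<Rightarrow> real" where
  "w_AWGNC x = (\<Sum>i < dim_vec x. x $ i)\<^sup>2 / (\<Sum>i < dim_vec x. (x $ i)\<^sup>2)"

definition w_maxfrac :: "real vec \<Rightarrow> real" where
  "w_maxfrac x = (\<Sum>i < dim_vec x. x $ i) / Max ((\<lambda>i. x $ i) ` {..<dim_vec x})"

definition nonincreasing_rearrangement :: "real vec \<Rightarrow> real list" where
  "nonincreasing_rearrangement x = rev (sort (list_of_vec x))"

(* For i - 1 < \<xi> \<le> i the ceiling of \<xi> is i, whose list position is i - 1. *)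
definition bsc_phi :: "real vec \<Rightarrow> real \<Rightarrow> real" where
  "bsc_phi x \<xi> = (if 0 < \<xi> \<and> \<xi> \<le> real (dim_vec x)
     then nonincreasing_rearrangement x ! (nat \<lceil>\<xi>\<rceil> - 1) else 0)"

definition bsc_Phi :: "real vec \<Rightarrow> real \<Rightarrow> real" where
  "bsc_Phi x \<xi> = integral {0..\<xi>} (bsc_phi x)"

(* bsc_Phi x need not be injective on {0..n} (it is constant past the support of x), so its
   inverse is taken only at the level where the preimage is unique. *)
definition w_BSC :: "real vec \<Rightarrow> real" where
  "w_BSC x = 2 * (THE \<xi>. \<xi> \<in> {0..real (dim_vec x)} \<and>
                          bsc_Phi x \<xi> = bsc_Phi x (real (dim_vec x)) / 2)"

(* A relation rather than a function, so that it includes that the minimum is attained. *)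
definition is_min_pseudoweight :: "(real vec \<Rightarrow> real) \<Rightarrow> bit mat \<Rightarrow> real \<Rightarrow> bool" where
  "is_min_pseudoweight w H a \<longleftrightarrow>
     (\<exists>x \<in> fundamental_cone H - {0\<^sub>v (dim_col H)}. w x = a) \<and>
     (\<forall>x \<in> fundamental_cone H - {0\<^sub>v (dim_col H)}. a \<le> w x)"

definition first_rows :: "nat \<Rightarrow> bit mat \<Rightarrow> bit mat" where
  "first_rows k H = mat k (dim_col H) (\<lambda>(j, i). H $$ (j, i))"

(* c 0, ..., c l are the columns and r 1, ..., r l the rows of a connecting path. *)
definition column_rel :: "bit mat \<Rightarrow> nat rel" where
  "column_rel G = {(i, i'). i < dim_col G \<and> i' < dim_col G \<and>
     (i = i' \<or>
      (\<exists>l::nat. 1 \<le> l \<and> (\<exists>c r. c 0 = i \<and> c l = i' \<and> (\<forall>s \<le> l. c s < dim_col G) \<and>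
         (\<forall>s \<in> {1..l}. r s < dim_row G \<and> {c (s - 1), c s} = row_support G (r s)))))}"

end

(* Every vector of the fundamental cone is constant on the equivalence classes, and the last row
   meets each class at most once. If x attains its maximum M on a class E disjoint from the last
   row, then E supports a codeword and sum x >= |E| M. Otherwise E contains some r in the last row,
   and the inequality for r shows that the remaining classes met by the last row contribute at
   least |F| M to sum x, where F is the smallest of them; now E and F together support a codeword.
   Hence the max-fractional weight is at least the minimum distance. It is a lower bound for
   the two other pseudoweights, and all three agree with the Hamming weight on codewords, which
   lie in the fundamental cone. *)
theory Submission
  imports Defs
begin

section \<open>Supports of codewords\<close>

text \<open>Over the two-element field a vector is determined by its support, so kernel membership
  becomes a parity condition on finite sets, easy to check for unions of classes.\<close>

definition codeword_support :: "bit mat \<Rightarrow> nat set \<Rightarrow> bool" where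
  "codeword_support H E \<longleftrightarrow> E \<subseteq> {..<dim_col H} \<and>
     (\<forall>j < dim_row H. even (card (row_support H j \<inter> E)))"

text \<open>Polymorphic in the entries: the same set yields a codeword over \<open>bit\<close> and a
  point of the cone over \<open>real\<close>.\<close>

definition indicator_vec :: "nat \<Rightarrow> nat set \<Rightarrow> 'a::zero_neq_one vec" where
  "indicator_vec n E = vec n (\<lambda>i. of_bool (i \<in> E))"

lemma finite_row_support [simp]: "finite (row_support H j)"
  by (simp add: row_support_def)

lemma dim_indicator_vec [simp]: "dim_vec (indicator_vec n E) = n"
  by (simp add: indicator_vec_def)

lemma indicator_vec_carrier: "indicator_vec n E \<in> carrier_vec n"
  by (intro carrier_vecI dim_indicator_vec)

lemma indicator_vec_index [simp]: "i < n \<Longrightarrow> indicator_vec n E $ i = of_bool (i \<in> E)"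
  by (simp add: indicator_vec_def)

lemma of_nat_bit_eq_0_iff: "(of_nat k :: bit) = 0 \<longleftrightarrow> even k"
  by (induction k) auto

text \<open>Each product of entries is 1 exactly on the common support, so the scalar product counts
  that set modulo 2.\<close>

lemma mult_mat_vec_bit_index:
  fixes c :: "bit vec"
  assumes "c \<in> carrier_vec (dim_col H)" "j < dim_row H"
  shows "(H *\<^sub>v c) $ j = of_nat (card (row_support H j \<inter> {i. i < dim_col H \<and> c $ i \<noteq> 0}))"
proof -
  have "(H *\<^sub>v c) $ j = (\<Sum>i<dim_col H. H $$ (j, i) * c $ i)"
    using assms by (auto simp: scalar_prod_def lessThan_atLeast0 intro!: sum.cong)
  also have "\<dots> = (\<Sum>i<dim_col H. if i \<in> row_support H j \<inter> {i. i < dim_col H \<and> c $ i \<noteq> 0} then 1 else 0)"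
    by (intro sum.cong) (auto simp: row_support_def)
  also have "\<dots> = of_nat (card ({..<dim_col H} \<inter> (row_support H j \<inter> {i. i < dim_col H \<and> c $ i \<noteq> 0})))"
    by (subst sum.inter_restrict [symmetric]) auto
  also have "{..<dim_col H} \<inter> (row_support H j \<inter> {i. i < dim_col H \<and> c $ i \<noteq> 0})
      = row_support H j \<inter> {i. i < dim_col H \<and> c $ i \<noteq> 0}"
    by auto
  finally show ?thesis .
qed

lemma mem_mat_kernel_iff_codeword_support:
  "c \<in> mat_kernel H \<longleftrightarrow> c \<in> carrier_vec (dim_col H) \<and>
     codeword_support H {i. i < dim_col H \<and> c $ i \<noteq> 0}"
proof -
  have "H *\<^sub>v c = 0\<^sub>v (dim_row H) \<longleftrightarrow>
      (\<forall>j<dim_row H. even (card (row_support H j \<inter> {i. i < dim_col H \<and> c $ i \<noteq> 0})))"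
    if "c \<in> carrier_vec (dim_col H)"
    using mult_mat_vec_bit_index[OF that] by (auto simp: vec_eq_iff of_nat_bit_eq_0_iff)
  then show ?thesis
    by (auto simp: mat_kernel_def codeword_support_def)
qed

lemma indicator_vec_mem_mat_kernel:
  assumes "codeword_support H E"
  shows "indicator_vec (dim_col H) E \<in> mat_kernel H"
proof -
  have "{i. i < dim_col H \<and> (indicator_vec (dim_col H) E :: bit vec) $ i \<noteq> 0} = E"
    using assms by (auto simp: codeword_support_def)
  then show ?thesis
    unfolding mem_mat_kernel_iff_codeword_support using assms indicator_vec_carrier by metis
qed

section \<open>Minimum distance as the least size of a nonempty codeword support\<close>

lemma hamming_dist_le: "hamming_dist u v \<le> dim_vec u"
proof -
  have "hamming_dist u v \<le> card {..<dim_vec u}"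
    unfolding hamming_dist_def by (intro card_mono) auto
  then show ?thesis by simp
qed

lemma finite_hamming_dists:
  "finite {hamming_dist u v | u v. u \<in> mat_kernel H \<and> v \<in> mat_kernel H \<and> u \<noteq> v}"
proof (rule finite_subset)
  show "{hamming_dist u v | u v. u \<in> mat_kernel H \<and> v \<in> mat_kernel H \<and> u \<noteq> v} \<subseteq> {..dim_col H}"
    using hamming_dist_le by (auto simp: mat_kernel_def) (metis carrier_vecD)
qed simp

lemma zero_mem_mat_kernel: "0\<^sub>v (dim_col H) \<in> mat_kernel H"
  by (auto simp: mat_kernel_def)

text \<open>The codeword with support \<open>E\<close> lies at distance \<open>card E\<close> from
  the zero codeword.\<close>

lemma min_distance_le_card:
  assumes "codeword_support H E" "E \<noteq> {}"
  shows "min_distance (mat_kernel H) \<le> card E"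
proof -
  let ?c = "indicator_vec (dim_col H) E :: bit vec"
  obtain i where i: "i \<in> E" "i < dim_col H"
    using assms by (auto simp: codeword_support_def)
  have "?c $ i \<noteq> 0\<^sub>v (dim_col H) $ i"
    using i by simp
  then have "?c \<noteq> 0\<^sub>v (dim_col H)"
    by metis
  moreover have "hamming_dist ?c (0\<^sub>v (dim_col H)) = card E"
    unfolding hamming_dist_def
    using assms by (intro arg_cong[of _ _ card]) (auto simp: codeword_support_def)
  ultimately show ?thesis
    unfolding min_distance_def
    using indicator_vec_mem_mat_kernel[OF assms(1)] zero_mem_mat_kernel[of H]
    by (intro Min_le finite_hamming_dists) (simp, metis)
qed

text \<open>By linearity, the difference of two codewords at minimum distance is again a codeword,
  supported where the two differ.\<close>

lemma min_distance_attained: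
  assumes "mat_kernel H \<noteq> {0\<^sub>v (dim_col H)}"
  obtains E where "codeword_support H E" "E \<noteq> {}" "card E = min_distance (mat_kernel H)"
proof -
  let ?D = "{hamming_dist u v | u v. u \<in> mat_kernel H \<and> v \<in> mat_kernel H \<and> u \<noteq> v}"
  have "?D \<noteq> {}"
    using assms zero_mem_mat_kernel[of H] by blast
  then have "Min ?D \<in> ?D"
    by (rule Min_in[OF finite_hamming_dists])
  then obtain u v where uv: "u \<in> mat_kernel H" "v \<in> mat_kernel H" "u \<noteq> v"
    and d: "min_distance (mat_kernel H) = hamming_dist u v"
    unfolding min_distance_def by blast
  have dims: "u \<in> carrier_vec (dim_col H)" "v \<in> carrier_vec (dim_col H)"
    using uv by (auto simp: mat_kernel_def)
  have "H *\<^sub>v (u - v) = 0\<^sub>v (dim_row H)"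
    using uv mult_minus_distrib_mat_vec[of H "dim_row H" "dim_col H" u v]
    by (auto simp: mat_kernel_def)
  then have "u - v \<in> mat_kernel H"
    using dims by (auto simp: mat_kernel_def)
  then have "codeword_support H {i. i < dim_col H \<and> (u - v) $ i \<noteq> 0}"
    by (simp add: mem_mat_kernel_iff_codeword_support)
  also have "{i. i < dim_col H \<and> (u - v) $ i \<noteq> 0} = {i. i < dim_vec u \<and> u $ i \<noteq> v $ i}"
    using dims by auto
  finally have "codeword_support H {i. i < dim_vec u \<and> u $ i \<noteq> v $ i}" .
  moreover have "{i. i < dim_vec u \<and> u $ i \<noteq> v $ i} \<noteq> {}"
    using uv(3) dims by (auto simp: vec_eq_iff)
  ultimately show thesis
    using that d unfolding hamming_dist_def by metis
qed

text \<open>If \<open>l\<close> lies in \<open>E\<close>, evenness forbids a row from meeting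
  \<open>E\<close> in \<open>l\<close> alone; a second common element already contributes 1 to the
  right-hand side.\<close>

lemma indicator_vec_mem_fundamental_cone:
  assumes "codeword_support H E"
  shows "indicator_vec (dim_col H) E \<in> fundamental_cone H"
proof -
  let ?x = "indicator_vec (dim_col H) E :: real vec"
  have "?x $ l \<le> (\<Sum>i \<in> row_support H j - {l}. ?x $ i)"
    if j: "j < dim_row H" and l: "l \<in> row_support H j" for j l
  proof -
    have idx: "i < dim_col H" if "i \<in> row_support H j" for i
      using that by (auto simp: row_support_def)
    have nonneg: "0 \<le> ?x $ i" if "i \<in> row_support H j - {l}" for i
      using idx that by simp
    show ?thesis
    proof (cases "l \<in> E")
      case True
      have "even (card (row_support H j \<inter> E))"
        using assms j by (simp add: codeword_support_def)
      then have "row_support H j \<inter> E \<noteq> {l}"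
        by auto
      then obtain k where k: "k \<in> row_support H j - {l}" "k \<in> E"
        using True l by auto
      have "?x $ l = ?x $ k"
        using k True l idx by simp
      also have "\<dots> \<le> (\<Sum>i \<in> row_support H j - {l}. ?x $ i)"
        using k nonneg by (intro member_le_sum) auto
      finally show ?thesis .
    next
      case False
      then have "?x $ l = 0"
        using idx[OF l] by simp
      also have "0 \<le> (\<Sum>i \<in> row_support H j - {l}. ?x $ i)"
        by (intro sum_nonneg nonneg)
      finally show ?thesis .
    qed
  qed
  moreover have "0 \<le> ?x $ i" if "i < dim_col H" for i
    using that by simp
  ultimately show ?thesis
    unfolding fundamental_cone_def using indicator_vec_carrier by blast
qed

section \<open>Comparison of pseudoweights\<close>

lemma le_Max_vec: "i < dim_vec x \<Longrightarrow> x $ i \<le> Max ((\<lambda>i. x $ i) ` {..<dim_vec x})"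
  for x :: "real vec"
  by (intro Max_ge) auto

lemma Max_vec_pos:
  fixes x :: "real vec"
  assumes "0 < (\<Sum>i<dim_vec x. x $ i)"
  shows "0 < Max ((\<lambda>i. x $ i) ` {..<dim_vec x})"
proof (rule ccontr)
  assume "\<not> ?thesis"
  then have "x $ i \<le> 0" if "i < dim_vec x" for i
    using le_Max_vec[OF that] by simp
  then have "(\<Sum>i<dim_vec x. x $ i) \<le> 0"
    by (intro sum_nonpos) auto
  with assms show False by simp
qed

text \<open>With \<open>M\<close> the maximum, \<open>S\<close> the sum and \<open>Q\<close> the sum
  of squares, bounding one factor of each square by \<open>M\<close> gives
  \<open>Q \<le> M * S\<close>, hence
  \<open>S / M = S\<^sup>2 / (M * S) \<le> S\<^sup>2 / Q\<close>.\<close>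

lemma w_maxfrac_le_w_AWGNC:
  assumes nonneg: "\<And>i. i < dim_vec x \<Longrightarrow> 0 \<le> x $ i"
    and pos: "0 < (\<Sum>i<dim_vec x. x $ i)"
  shows "w_maxfrac x \<le> w_AWGNC x"
proof -
  define M where "M = Max ((\<lambda>i. x $ i) ` {..<dim_vec x})"
  define S where "S = (\<Sum>i<dim_vec x. x $ i)"
  define Q where "Q = (\<Sum>i<dim_vec x. (x $ i)\<^sup>2)"
  have M: "0 < M"
    unfolding M_def by (rule Max_vec_pos[OF pos])
  have S: "0 < S"
    using pos by (simp add: S_def)
  have "Q \<le> (\<Sum>i<dim_vec x. M * x $ i)"
    unfolding Q_def power2_eq_square M_def
    using nonneg le_Max_vec by (intro sum_mono mult_right_mono) auto
  then have QS: "Q \<le> M * S"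
    by (simp add: S_def sum_distrib_left)
  have "Q \<noteq> 0"
  proof
    assume "Q = 0"
    then have "\<forall>i<dim_vec x. x $ i = 0"
      by (simp add: Q_def sum_nonneg_eq_0_iff)
    with pos show False by simp
  qed
  moreover have "0 \<le> Q"
    by (simp add: Q_def sum_nonneg)
  ultimately have Q: "0 < Q" by simp
  have "S / M = S\<^sup>2 / (M * S)"
    using S by (simp add: power2_eq_square)
  also have "\<dots> \<le> S\<^sup>2 / Q"
    using QS Q by (intro divide_left_mono) (use M S in auto)
  finally show ?thesis
    by (simp add: w_maxfrac_def w_AWGNC_def M_def S_def Q_def)
qed

section \<open>Non-increasing rearrangement, its integral and the BSC pseudoweight\<close>

lemma length_nonincreasing_rearrangement [simp]:
  "length (nonincreasing_rearrangement x) = dim_vec x"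
  by (simp add: nonincreasing_rearrangement_def)

lemma nonincreasing_rearrangement_antimono:
  assumes "i \<le> k" "k < dim_vec x"
  shows "nonincreasing_rearrangement x ! k \<le> nonincreasing_rearrangement x ! i"
proof -
  have "sorted (rev (nonincreasing_rearrangement x))"
    by (simp add: nonincreasing_rearrangement_def)
  then show ?thesis
    using sorted_rev_nth_mono assms by (metis length_nonincreasing_rearrangement)
qed

lemma nonincreasing_rearrangement_mem:
  assumes "i < dim_vec x"
  shows "\<exists>k<dim_vec x. nonincreasing_rearrangement x ! i = x $ k"
proof -
  have "nonincreasing_rearrangement x ! i \<in> set (nonincreasing_rearrangement x)"
    using assms by simp
  also have "\<dots> = set (list_of_vec x)"
    by (simp add: nonincreasing_rearrangement_def)
  finally show ?thesis
    by (auto simp: in_set_conv_nth list_of_vec_index)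
qed

lemma sum_nonincreasing_rearrangement:
  "(\<Sum>i<dim_vec x. nonincreasing_rearrangement x ! i) = (\<Sum>i<dim_vec x. x $ i)"
proof -
  have "(\<Sum>i<dim_vec x. nonincreasing_rearrangement x ! i) = sum_list (nonincreasing_rearrangement x)"
    by (simp add: sum_list_sum_nth lessThan_atLeast0)
  also have "\<dots> = sum_mset (mset (nonincreasing_rearrangement x))"
    by (simp only: sum_mset_sum_list)
  also have "\<dots> = sum_list (list_of_vec x)"
    by (simp add: nonincreasing_rearrangement_def sum_mset_sum_list)
  also have "\<dots> = (\<Sum>i<dim_vec x. x $ i)"
    by (simp add: sum_list_sum_nth lessThan_atLeast0 list_of_vec_index)
  finally show ?thesis .
qed

text \<open>Splitting the step function into one step per unit interval allows termwise
  integration.\<close>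

lemma bsc_phi_eq_sum:
  "bsc_phi x t = (\<Sum>i<dim_vec x. if t \<in> {real i<..real i + 1} then nonincreasing_rearrangement x ! i else 0)"
proof (cases "0 < t \<and> t \<le> real (dim_vec x)")
  case True
  define k where "k = nat \<lceil>t\<rceil> - 1"
  have k: "k < dim_vec x"
    using True unfolding k_def by linarith
  have iff: "t \<in> {real i<..real i + 1} \<longleftrightarrow> i = k" for i
    using True unfolding k_def greaterThanAtMost_iff by linarith
  have "bsc_phi x t = nonincreasing_rearrangement x ! k"
    unfolding bsc_phi_def k_def using True by (rule if_P)
  also have "\<dots> = (\<Sum>i<dim_vec x. if i = k then nonincreasing_rearrangement x ! i else 0)"
    using k by simp
  finally show ?thesis
    unfolding iff .
next
  case False
  have "t \<notin> {real i<..real i + 1}" if "i < dim_vec x" for i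
    using False that by auto
  then show ?thesis
    using False by (auto simp: bsc_phi_def)
qed

text \<open>The factor \<open>max 0 (min 1 (b - a))\<close> is the length of the part of the step's
  interval that lies in \<open>{0..b}\<close>.\<close>

lemma has_integral_half_open_step:
  fixes a b y :: real
  assumes "0 \<le> a"
  shows "((\<lambda>t. if t \<in> {a<..a + 1} then y else 0) has_integral y * max 0 (min 1 (b - a))) {0..b}"
proof -
  have "((\<lambda>t. y) has_integral y * max 0 (min 1 (b - a))) {a..min b (a + 1)}"
  proof (cases "a \<le> b")
    case True
    then have "max 0 (min 1 (b - a)) = min b (a + 1) - a" by auto
    then show ?thesis
      using has_integral_const_real[of y a "min b (a + 1)"] True by (simp add: mult.commute)
  next
    case False
    then show ?thesis by simp
  qed
  \<comment> \<open>The half-open and the closed interval differ at most in the point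
    \<open>a\<close>, which is negligible.\<close>
  then have "((\<lambda>t. y) has_integral y * max 0 (min 1 (b - a))) ({a<..a + 1} \<inter> {0..b})"
    by (rule has_integral_spike_set_eq[THEN iffD1, rotated 2])
       (use assms in \<open>auto intro!: negligible_subset[OF negligible_sing[of a]]\<close>)
  then show ?thesis
    by (subst has_integral_restrict_Int)
qed

lemma has_integral_bsc_phi:
  "(bsc_phi x has_integral
     (\<Sum>i<dim_vec x. nonincreasing_rearrangement x ! i * max 0 (min 1 (b - real i)))) {0..b}"
  unfolding bsc_phi_eq_sum[abs_def]
  by (intro has_integral_sum has_integral_half_open_step) auto

text \<open>This piecewise linear closed form makes continuity evident and reduces comparisons of
  values to finite sums.\<close>

lemma bsc_Phi_eq:
  "bsc_Phi x b = (\<Sum>i<dim_vec x. nonincreasing_rearrangement x ! i * max 0 (min 1 (b - real i)))"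
  unfolding bsc_Phi_def using has_integral_bsc_phi by (rule integral_unique)

lemma bsc_Phi_dim: "bsc_Phi x (real (dim_vec x)) = (\<Sum>i<dim_vec x. x $ i)"
proof -
  have "bsc_Phi x (real (dim_vec x)) = (\<Sum>i<dim_vec x. nonincreasing_rearrangement x ! i)"
    unfolding bsc_Phi_eq by (intro sum.cong) auto
  then show ?thesis
    by (simp add: sum_nonincreasing_rearrangement)
qed

text \<open>The integrand is bounded by \<open>M\<close> everywhere; \<open>0 \<le> M\<close> covers
  its default value 0 outside the range of the steps.\<close>

lemma bsc_Phi_le:
  assumes "\<And>i. i < dim_vec x \<Longrightarrow> x $ i \<le> M" "0 \<le> M" "0 \<le> b"
  shows "bsc_Phi x b \<le> M * b"
proof -
  have "bsc_phi x t \<le> M" for t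
  proof (cases "0 < t \<and> t \<le> real (dim_vec x)")
    case True
    then have "nat \<lceil>t\<rceil> - 1 < dim_vec x" by linarith
    from nonincreasing_rearrangement_mem[OF this] show ?thesis
      using True assms(1) by (auto simp: bsc_phi_def)
  qed (use assms(2) in \<open>auto simp: bsc_phi_def\<close>)
  moreover have "((\<lambda>t. M) has_integral M * b) {0..b}"
    using has_integral_const_real[of M 0 b] assms(3) by (simp add: mult.commute)
  ultimately show ?thesis
    unfolding bsc_Phi_eq using has_integral_le[OF has_integral_bsc_phi] by blast
qed

text \<open>Equality of \<^term>\<open>bsc_Phi x\<close> at two points forces the rearrangement to vanish from the larger
  point on, which is impossible at half of the total mass.\<close>

lemma bsc_Phi_eq_imp_ge_total:
  assumes nonneg: "\<And>i. i < dim_vec x \<Longrightarrow> 0 \<le> x $ i"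
    and "0 \<le> a" "a < b" "b \<le> real (dim_vec x)" "bsc_Phi x a = bsc_Phi x b"
  shows "bsc_Phi x b = (\<Sum>i<dim_vec x. x $ i)"
proof -
  let ?y = "\<lambda>i. nonincreasing_rearrangement x ! i"
  let ?c = "\<lambda>t i. max 0 (min 1 (t - real i)) :: real"
  have y: "0 \<le> ?y i" if "i < dim_vec x" for i
    using nonincreasing_rearrangement_mem[OF that] nonneg by auto
  have "(\<Sum>i<dim_vec x. ?y i * (?c b i - ?c a i)) = 0"
    using assms(5) by (simp add: bsc_Phi_eq right_diff_distrib sum_subtractf)
  moreover have "0 \<le> ?y i * (?c b i - ?c a i)" if "i < dim_vec x" for i
    using y[OF that] assms(3) by (intro mult_nonneg_nonneg) auto
  ultimately have eq0: "?y i * (?c b i - ?c a i) = 0" if "i < dim_vec x" for i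
    using that by (subst (asm) sum_nonneg_eq_0_iff) auto
  \<comment> \<open>The step with index \<open>k\<close> is the one whose interval contains
    \<open>b\<close>, so its weight is strictly larger at \<open>b\<close> than at \<open>a\<close>;
    equality of the integrals then forces its height to be 0.\<close>
  define k where "k = nat \<lceil>b\<rceil> - 1"
  have k: "real k < b" "b \<le> real k + 1" "k < dim_vec x"
    using assms(2-4) unfolding k_def by linarith+
  have "?c b k \<noteq> ?c a k"
    using k assms(3) by auto
  then have "?y k = 0"
    using eq0[OF k(3)] by simp
  then have zero: "?y i = 0" if "k \<le> i" "i < dim_vec x" for i
    using nonincreasing_rearrangement_antimono[OF that] y[OF that(2)] by simp
  have "?y i * ?c b i = ?y i" if "i < dim_vec x" for i
  proof (cases "k \<le> i")
    case False
    then have "real i + 1 \<le> real k" by linarith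
    then show ?thesis using k(1) by simp
  qed (use zero that in simp)
  then have "bsc_Phi x b = (\<Sum>i<dim_vec x. ?y i)"
    unfolding bsc_Phi_eq by (intro sum.cong) auto
  then show ?thesis
    by (simp add: sum_nonincreasing_rearrangement)
qed

text \<open>The definite description needs uniqueness: at a second solution \<open>bsc_Phi x\<close>
  would be constant between the two, making half of the positive total equal to the total.\<close>

lemma w_BSC_eqI:
  assumes nonneg: "\<And>i. i < dim_vec x \<Longrightarrow> 0 \<le> x $ i"
    and pos: "0 < (\<Sum>i<dim_vec x. x $ i)"
    and b: "0 \<le> b" "b \<le> real (dim_vec x)" "bsc_Phi x b = (\<Sum>i<dim_vec x. x $ i) / 2"
  shows "w_BSC x = 2 * b"
proof -
  have less: False
    if "0 \<le> s" "s < t" "t \<le> real (dim_vec x)"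
      "bsc_Phi x s = (\<Sum>i<dim_vec x. x $ i) / 2" "bsc_Phi x t = (\<Sum>i<dim_vec x. x $ i) / 2" for s t
    using bsc_Phi_eq_imp_ge_total[OF nonneg that(1-3)] that(4,5) pos by simp
  have "(THE t. t \<in> {0..real (dim_vec x)} \<and> bsc_Phi x t = bsc_Phi x (real (dim_vec x)) / 2) = b"
  proof (rule the_equality)
    fix t
    assume "t \<in> {0..real (dim_vec x)} \<and> bsc_Phi x t = bsc_Phi x (real (dim_vec x)) / 2"
    then show "t = b"
      using less[of t b] less[of b t] b by (force simp: bsc_Phi_dim)
  qed (use b in \<open>simp add: bsc_Phi_dim\<close>)
  then show ?thesis
    by (simp add: w_BSC_def)
qed

text \<open>The intermediate value theorem supplies a point \<open>b\<close> where half of the total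
  \<open>S\<close> is reached; since heights are at most \<open>M\<close>,
  \<open>S / 2 \<le> M * b\<close>.\<close>

lemma w_maxfrac_le_w_BSC:
  assumes nonneg: "\<And>i. i < dim_vec x \<Longrightarrow> 0 \<le> x $ i"
    and pos: "0 < (\<Sum>i<dim_vec x. x $ i)"
  shows "w_maxfrac x \<le> w_BSC x"
proof -
  define M where "M = Max ((\<lambda>i. x $ i) ` {..<dim_vec x})"
  define S where "S = (\<Sum>i<dim_vec x. x $ i)"
  have "continuous_on {0..real (dim_vec x)} (bsc_Phi x)"
    unfolding bsc_Phi_eq[abs_def] by (intro continuous_intros)
  moreover have "bsc_Phi x 0 = 0"
    by (simp add: bsc_Phi_eq)
  ultimately obtain b where b: "0 \<le> b" "b \<le> real (dim_vec x)" "bsc_Phi x b = S / 2"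
    using IVT'[of "bsc_Phi x" 0 "S / 2" "real (dim_vec x)"] pos
    by (auto simp: bsc_Phi_dim S_def)
  have M: "0 < M"
    unfolding M_def by (rule Max_vec_pos[OF pos])
  have "S / 2 \<le> M * b"
    using bsc_Phi_le[of x M b] le_Max_vec[of _ x] M b by (simp add: M_def)
  then have "S / M \<le> 2 * b"
    using M by (simp add: field_simps)
  also have "2 * b = w_BSC x"
    using w_BSC_eqI[OF nonneg pos b(1,2)] b(3) by (simp add: S_def)
  finally show ?thesis
    by (simp add: w_maxfrac_def M_def S_def)
qed

section \<open>Pseudoweights of indicator vectors\<close>

lemma sum_indicator_vec:
  assumes "E \<subseteq> {..<n}"
  shows "(\<Sum>i<n. indicator_vec n E $ i) = real (card E)"
proof -
  have "(\<Sum>i<n. indicator_vec n E $ i) = (\<Sum>i<n. if i \<in> E then 1 else (0::real))"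
    by (intro sum.cong) auto
  also have "\<dots> = real (card ({..<n} \<inter> E))"
    by (subst sum.inter_restrict [symmetric]) auto
  finally show ?thesis
    using assms by (simp add: Int_absorb1)
qed

lemma Max_indicator_vec:
  assumes "E \<subseteq> {..<n}" "E \<noteq> {}"
  shows "Max ((\<lambda>i. indicator_vec n E $ i) ` {..<n}) = (1::real)"
proof (rule Max_eqI)
  obtain i where "i \<in> E" "i < n"
    using assms by auto
  then show "(1::real) \<in> (\<lambda>i. indicator_vec n E $ i) ` {..<n}"
    by (intro image_eqI[of _ _ i]) auto
qed auto

lemma w_maxfrac_indicator_vec:
  assumes "E \<subseteq> {..<n}" "E \<noteq> {}"
  shows "w_maxfrac (indicator_vec n E) = real (card E)"
  using sum_indicator_vec[OF assms(1)] Max_indicator_vec[OF assms] by (simp add: w_maxfrac_def)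

lemma w_AWGNC_indicator_vec:
  assumes "E \<subseteq> {..<n}"
  shows "w_AWGNC (indicator_vec n E) = real (card E)"
proof -
  have "(\<Sum>i<n. (indicator_vec n E $ i)\<^sup>2) = (\<Sum>i<n. indicator_vec n E $ i :: real)"
    by (intro sum.cong) auto
  then show ?thesis
    using sum_indicator_vec[OF assms] by (simp add: w_AWGNC_def power2_eq_square)
qed

text \<open>The rearrangement begins with \<open>card E\<close> ones, so half of the total is
  reached at \<open>card E / 2\<close>.\<close>

lemma w_BSC_indicator_vec:
  assumes E: "E \<subseteq> {..<n}" "E \<noteq> {}"
  shows "w_BSC (indicator_vec n E) = real (card E)"
proof -
  let ?x = "indicator_vec n E :: real vec"
  let ?y = "\<lambda>i. nonincreasing_rearrangement ?x ! i"
  have fin: "finite E"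
    using E(1) finite_subset by blast
  have card: "0 < card E" "card E \<le> n"
    using E fin card_mono[of "{..<n}" E] by (auto simp: card_gt_0_iff)
  have sum: "(\<Sum>i<n. ?x $ i) = real (card E)"
    by (rule sum_indicator_vec[OF E(1)])
  have y01: "?y i = 0 \<or> ?y i = 1" if "i < n" for i
    using nonincreasing_rearrangement_mem[of i ?x] that by auto
  \<comment> \<open>A zero at position \<open>i\<close> would propagate to all later positions,
    leaving a sum of at most \<open>i\<close>, less than \<open>card E\<close>.\<close>
  have y1: "?y i = 1" if i: "i < card E" for i
  proof (rule ccontr)
    assume "?y i \<noteq> 1"
    then have "?y i = 0"
      using y01[of i] i card by simp
    then have "?y k = 0" if "k < n" "i \<le> k" for k
      using y01[OF that(1)] nonincreasing_rearrangement_antimono[of i k ?x] that by force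
    then have "?y k \<le> (if k < i then 1 else 0)" if "k < n" for k
      using y01[OF that] that by force
    then have "(\<Sum>k<n. ?y k) \<le> (\<Sum>k<n. if k \<in> {..<i} then 1 else 0)"
      by (intro sum_mono) auto
    also have "\<dots> = real (card ({..<n} \<inter> {..<i}))"
      by (subst sum.inter_restrict [symmetric]) auto
    also have "{..<n} \<inter> {..<i} = {..<i}"
      using i card by auto
    finally have "(\<Sum>k<n. ?y k) \<le> real i"
      by simp
    moreover have "(\<Sum>k<n. ?y k) = real (card E)"
      using sum_nonincreasing_rearrangement[of ?x] sum by simp
    ultimately show False
      using i by simp
  qed
  \<comment> \<open>The point 0 is excluded because \<open>bsc_phi\<close> has its default value 0
    there; the integral ignores it.\<close>
  have phi: "bsc_phi ?x t = 1" if "t \<in> {0..real (card E) / 2} - {0}" for t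
  proof -
    have "0 < t" "t \<le> real (card E)"
      using that by auto
    moreover from this have "nat \<lceil>t\<rceil> - 1 < card E"
      by linarith
    ultimately show ?thesis
      using card y1 by (simp add: bsc_phi_def)
  qed
  have "((\<lambda>t. 1::real) has_integral real (card E) / 2) {0..real (card E) / 2}"
    using has_integral_const_real[of "1::real" 0 "real (card E) / 2"] by simp
  then have "(bsc_phi ?x has_integral real (card E) / 2) {0..real (card E) / 2}"
    by (rule has_integral_spike[OF negligible_sing[of 0], rotated]) (rule phi)
  then have "bsc_Phi ?x (real (card E) / 2) = (\<Sum>i<dim_vec ?x. ?x $ i) / 2"
    using sum by (simp add: bsc_Phi_def integral_unique)
  then have "w_BSC ?x = 2 * (real (card E) / 2)"
    using card sum by (intro w_BSC_eqI) auto
  then show ?thesis by simp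
qed

section \<open>The equivalence relation on columns\<close>

text \<open>Rows are read as edges of a graph on the columns, so that classes become connected
  components and the theory of \<open>rtrancl\<close> replaces explicit paths.\<close>

definition edge_rel :: "bit mat \<Rightarrow> nat rel" where
  "edge_rel G = {(a, b). \<exists>j<dim_row G. row_support G j = {a, b}}"

lemma sym_edge_rel: "sym (edge_rel G)"
  by (auto simp: edge_rel_def sym_def insert_commute)

lemma edge_rel_bounds: "(a, b) \<in> edge_rel G \<Longrightarrow> a < dim_col G \<and> b < dim_col G"
  by (auto simp: edge_rel_def row_support_def)

lemma column_rel_eq_rtrancl:
  "column_rel G = {(a, b). a < dim_col G \<and> b < dim_col G \<and> (a, b) \<in> (edge_rel G)\<^sup>*}"
proof (intro equalityI subrelI)
  fix a b
  assume ab: "(a, b) \<in> column_rel G"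
  have "(a, b) \<in> (edge_rel G)\<^sup>*"
  proof (cases "a = b")
    case False
    with ab obtain l :: nat and c r where cr: "c 0 = a" "c l = b"
      "\<forall>s\<in>{1..l}. r s < dim_row G \<and> {c (s - 1), c s} = row_support G (r s)"
      unfolding column_rel_def by auto
    have "(c i, c (Suc i)) \<in> edge_rel G" if "i < l" for i
      using cr(3)[rule_format, of "Suc i"] that by (auto simp: edge_rel_def)
    then have "(a, b) \<in> edge_rel G ^^ l"
      unfolding relpow_fun_conv using cr(1,2) by blast
    then show ?thesis
      by (rule relpow_imp_rtrancl)
  qed simp
  with ab show "(a, b) \<in> {(a, b). a < dim_col G \<and> b < dim_col G \<and> (a, b) \<in> (edge_rel G)\<^sup>*}"
    by (auto simp: column_rel_def)
next
  fix a b
  assume "(a, b) \<in> {(a, b). a < dim_col G \<and> b < dim_col G \<and> (a, b) \<in> (edge_rel G)\<^sup>*}"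
  then have ab: "a < dim_col G" "b < dim_col G" "(a, b) \<in> (edge_rel G)\<^sup>*"
    by auto
  show "(a, b) \<in> column_rel G"
  proof (cases "a = b")
    case False
    from ab(3) obtain l where "(a, b) \<in> edge_rel G ^^ l"
      by (auto simp: rtrancl_power)
    then obtain c where c: "c 0 = a" "c l = b" "\<forall>i<l. (c i, c (Suc i)) \<in> edge_rel G"
      by (auto simp: relpow_fun_conv)
    then have "\<forall>i<l. \<exists>j<dim_row G. row_support G j = {c i, c (Suc i)}"
      by (auto simp: edge_rel_def)
    then obtain r where r: "\<forall>i<l. r i < dim_row G \<and> row_support G (r i) = {c i, c (Suc i)}"
      by metis
    have "1 \<le> l"
      using False c by (cases l) auto
    moreover have "c s < dim_col G" if "s \<le> l" for s
      using c ab(2) that edge_rel_bounds by (metis order_le_less)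
    \<comment> \<open>Paths in \<open>column_rel\<close> number their rows from 1, whereas the edges
      from \<open>relpow\<close> are numbered from 0; hence the shift.\<close>
    moreover have "r (s - 1) < dim_row G \<and> {c (s - 1), c s} = row_support G (r (s - 1))"
      if "s \<in> {1..l}" for s
      using r[rule_format, of "s - 1"] that by auto
    ultimately show ?thesis
      unfolding column_rel_def using ab(1,2) c(1,2)
      by (intro CollectI case_prodI conjI disjI2 exI[of _ l] exI[of _ c] exI[of _ "\<lambda>s. r (s - 1)"]) auto
  qed (use ab in \<open>simp add: column_rel_def\<close>)
qed

lemma equiv_column_rel: "equiv {..<dim_col G} (column_rel G)"
proof (rule equivI)
  show "refl_on {..<dim_col G} (column_rel G)"
    by (auto simp: refl_on_def column_rel_eq_rtrancl)
  show "sym (column_rel G)"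
    using sym_rtrancl[OF sym_edge_rel[of G]] by (auto simp: column_rel_eq_rtrancl sym_def)
  show "trans (column_rel G)"
    by (auto simp: column_rel_eq_rtrancl trans_def intro: rtrancl_trans)
qed (auto simp: column_rel_eq_rtrancl)

section \<open>Consequences of rows of weight two\<close>

lemma row_support_first_rows:
  assumes "j < k"
  shows "row_support (first_rows k H) j = row_support H j"
  using assms by (auto simp: row_support_def first_rows_def)

lemma edge_rel_first_rows:
  "edge_rel (first_rows k H) = {(a, b). \<exists>j<k. row_support H j = {a, b}}"
  using row_support_first_rows by (auto simp: edge_rel_def first_rows_def)

text \<open>Such a row has both of its columns in \<open>E\<close> or neither.\<close>

lemma even_card_row_support_Int_closed:
  assumes "card (row_support H j) = 2"
    and closed: "\<And>a b. row_support H j = {a, b} \<Longrightarrow> a \<in> E \<longleftrightarrow> b \<in> E"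
  shows "even (card (row_support H j \<inter> E))"
proof -
  obtain a b where ab: "row_support H j = {a, b}" "a \<noteq> b"
    using assms(1) by (auto simp: card_2_iff)
  then show ?thesis
    using closed[OF ab(1)] by (cases "a \<in> E") auto
qed

text \<open>For a row with two columns the cone inequalities bound each coordinate by the other; the
  resulting equality passes along paths by induction.\<close>

lemma fundamental_cone_column_rel:
  assumes x: "x \<in> fundamental_cone H" and k: "k \<le> dim_row H"
    and two: "\<forall>j<k. card (row_support H j) = 2"
    and rel: "(a, b) \<in> column_rel (first_rows k H)"
  shows "x $ a = x $ b"
proof -
  have edge: "x $ a = x $ b" if ab: "(a, b) \<in> edge_rel (first_rows k H)" for a b
  proof -
    obtain j where j: "j < k" "row_support H j = {a, b}"
      using ab by (auto simp: edge_rel_first_rows)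
    then have "a \<noteq> b"
      using two by fastforce
    then have "{a, b} - {a} = {b}" "{a, b} - {b} = {a}"
      by auto
    moreover have "x $ l \<le> (\<Sum>i\<in>{a, b} - {l}. x $ i)" if "l \<in> {a, b}" for l
    proof -
      have "j < dim_row H"
        using j(1) k by simp
      then have "\<forall>l\<in>row_support H j. x $ l \<le> (\<Sum>i\<in>row_support H j - {l}. x $ i)"
        using x by (simp add: fundamental_cone_def)
      then show ?thesis
        unfolding j(2) using that by blast
    qed
    ultimately have "x $ a \<le> x $ b" "x $ b \<le> x $ a"
      by (metis insertCI sum.empty sum.insert finite.emptyI empty_iff add_0_right)+
    then show ?thesis by simp
  qed
  have "(a, b) \<in> (edge_rel (first_rows k H))\<^sup>*"
    using rel by (simp add: column_rel_eq_rtrancl)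
  then show ?thesis
    by (induction rule: rtrancl_induct) (use edge in auto)
qed

section \<open>The lower bound on the fundamental cone\<close>

text \<open>This is the bound on \<open>w_maxfrac\<close> cleared of its denominator:
  \<open>p\<close> is later taken where \<open>x\<close> is maximal.\<close>

lemma min_distance_mult_le_sum:
  fixes x :: "real vec"
  assumes m: "dim_row H = m" "1 \<le> m"
    and two: "\<forall>j<m - 1. card (row_support H j) = 2"
    and classes: "\<forall>E \<in> {..<dim_col H} // column_rel (first_rows (m - 1) H).
      card (row_support H (m - 1) \<inter> E) \<le> 1"
    and x: "x \<in> fundamental_cone H"
    and p: "p < dim_col H" "0 < x $ p"
  shows "real (min_distance (mat_kernel H)) * x $ p \<le> (\<Sum>i<dim_col H. x $ i)"
proof -
  define n where "n = dim_col H"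
  define S where "S = column_rel (first_rows (m - 1) H)"
  define R where "R = row_support H (m - 1)"
  define cl where "cl i = S `` {i}" for i
  define d where "d = min_distance (mat_kernel H)"
  have equiv: "equiv {..<n} S"
    using equiv_column_rel[of "first_rows (m - 1) H"] by (simp add: S_def n_def first_rows_def)
  have R: "R \<subseteq> {..<n}" "finite R"
    by (auto simp: R_def n_def row_support_def)
  have cl_sub: "cl i \<subseteq> {..<n}" for i
    using equiv_type[OF equiv] by (auto simp: cl_def)
  have fin_cl [simp]: "finite (cl i)" for i
    using cl_sub finite_subset by blast
  have self: "i \<in> cl i" if "i < n" for i
    using equiv_class_self[OF equiv] that by (simp add: cl_def)
  have const: "x $ k = x $ i" if "k \<in> cl i" for i k
    using fundamental_cone_column_rel[OF x _ two, of i k] that m by (simp add: cl_def S_def)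
  have nonneg: "0 \<le> x $ i" if "i < n" for i
    using x that by (auto simp: fundamental_cone_def n_def)
  \<comment> \<open>The hypothesis allows at most one common element, and \<open>r\<close> is
    one.\<close>
  have R_cl: "R \<inter> cl r = {r}" if "r \<in> R" for r
  proof -
    have r: "r < n" using that R by auto
    have "cl r \<in> {..<n} // S"
      using r by (auto simp: cl_def intro: quotientI)
    then have "card (R \<inter> cl r) \<le> 1"
      using classes by (simp add: R_def S_def n_def)
    then show ?thesis
      using that self[OF r] R(2) by (auto simp: card_le_Suc0_iff_eq)
  qed
  have closed: "even (card (row_support H j \<inter> cl i))" if j: "j < m - 1" for i j
  proof (rule even_card_row_support_Int_closed)
    show "card (row_support H j) = 2"
      using two j by blast
    fix a b
    assume ab: "row_support H j = {a, b}"
    then have "(a, b) \<in> edge_rel (first_rows (m - 1) H)"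
      using j by (auto simp: edge_rel_first_rows)
    moreover have "a < n" "b < n"
      using ab by (auto simp: row_support_def n_def)
    ultimately have "(a, b) \<in> S"
      by (auto simp: S_def column_rel_eq_rtrancl n_def first_rows_def)
    then show "a \<in> cl i \<longleftrightarrow> b \<in> cl i"
      using equiv by (auto simp: cl_def equiv_def dest: transD symD)
  qed
  have disj: "cl i \<inter> cl k = {}" if "i \<notin> cl k" "i < n" for i k
    using equiv_class_nondisjoint[OF equiv, of _ k i] that
    by (fastforce simp: cl_def)
  \<comment> \<open>Row \<open>m - 1\<close> is the last one, so sets built from classes only remain
    to be tested against \<open>R\<close>.\<close>
  have rows: "even (card (row_support H j \<inter> E))"
    if "j < dim_row H" "\<forall>j<m-1. even (card (row_support H j \<inter> E))" "even (card (R \<inter> E))" for j E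
    using that m by (cases "j = m - 1") (auto simp: R_def)
  have sum_cl: "(\<Sum>i\<in>cl k. x $ i) = real (card (cl k)) * x $ k" for k
    using const by simp
  show ?thesis
  proof (cases "R \<inter> cl p = {}")
    case True
    have "codeword_support H (cl p)"
      unfolding codeword_support_def using cl_sub rows closed True by (simp add: n_def)
    then have "d \<le> card (cl p)"
      unfolding d_def using self p by (intro min_distance_le_card) (auto simp: n_def)
    then have "real d * x $ p \<le> real (card (cl p)) * x $ p"
      using p by (intro mult_right_mono) auto
    also have "\<dots> \<le> (\<Sum>i<n. x $ i)"
      unfolding sum_cl[symmetric] using cl_sub nonneg by (intro sum_mono2) auto
    finally show ?thesis
      by (simp add: d_def n_def)
  next
    case False
    then obtain r where r: "r \<in> R" "r \<in> cl p"
      by auto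
    have r_lt: "r < n" and xr: "x $ r = x $ p"
      using r R const by auto
    have le: "x $ r \<le> (\<Sum>s\<in>R - {r}. x $ s)"
      using x r m by (auto simp: fundamental_cone_def R_def)
    \<comment> \<open>An empty sum would bound the positive \<open>x $ r\<close> by 0.\<close>
    then have ne: "R - {r} \<noteq> {}"
      using p xr by (metis sum.empty not_le)
    \<comment> \<open>Choosing the smallest class lets \<open>card (cl s)\<close> be replaced later
      by \<open>card (cl k)\<close> in every term of the sum over \<open>R - {r}\<close>.\<close>
    obtain s where s: "s \<in> R - {r}" and s_min: "\<And>k. k \<in> R - {r} \<Longrightarrow> card (cl s) \<le> card (cl k)"
    proof
      have fin: "finite (R - {r})"
        using R(2) by simp
      show "arg_min_on (\<lambda>k. card (cl k)) (R - {r}) \<in> R - {r}"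
        by (rule arg_min_if_finite(1)[OF fin ne])
      show "card (cl (arg_min_on (\<lambda>k. card (cl k)) (R - {r}))) \<le> card (cl k)"
        if "k \<in> R - {r}" for k
        by (rule arg_min_least[OF fin ne that])
    qed
    have disj_R: "cl k \<inter> cl l = {}" if "k \<in> R" "l \<in> R" "k \<noteq> l" for k l
      using disj[of k l] R_cl[OF that(2)] that R(1) by auto
    have "codeword_support H (cl r \<union> cl s)"
      unfolding codeword_support_def
    proof (intro conjI allI impI)
      have dj: "cl r \<inter> cl s = {}"
        using disj_R r s by auto
      fix j assume "j < dim_row H"
      then show "even (card (row_support H j \<inter> (cl r \<union> cl s)))"
      proof (rule rows)
        show "\<forall>j<m - 1. even (card (row_support H j \<inter> (cl r \<union> cl s)))"
        proof (intro allI impI)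
          fix j assume j: "j < m - 1"
          have "card (row_support H j \<inter> (cl r \<union> cl s)) =
              card (row_support H j \<inter> cl r) + card (row_support H j \<inter> cl s)"
            unfolding Int_Un_distrib using dj by (intro card_Un_disjoint) auto
          then show "even (card (row_support H j \<inter> (cl r \<union> cl s)))"
            using closed[OF j] by simp
        qed
        \<comment> \<open>Each of the two classes contributes exactly one column, which gives even
          parity in the last row.\<close>
        have "R \<inter> (cl r \<union> cl s) = {r, s}"
          using R_cl[OF r(1)] R_cl[of s] s by (auto simp: Int_Un_distrib)
        then show "even (card (R \<inter> (cl r \<union> cl s)))"
          using s by auto
      qed
    qed (use cl_sub in \<open>auto simp: n_def\<close>)
    then have "d \<le> card (cl r \<union> cl s)"
      unfolding d_def using self[OF r_lt] by (intro min_distance_le_card) auto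
    also have "\<dots> \<le> card (cl r) + card (cl s)"
      by (rule card_Un_le)
    finally have "real d * x $ p \<le> (real (card (cl r)) + real (card (cl s))) * x $ r"
      unfolding xr using p by (intro mult_right_mono) auto
    also have "\<dots> = real (card (cl r)) * x $ r + real (card (cl s)) * x $ r"
      by (simp add: distrib_right)
    \<comment> \<open>The cone inequality at \<open>r\<close> trades the second copy of
      \<open>x $ r\<close> for the other coordinates in \<open>R\<close>; weighting these by class
      sizes recovers sums of \<open>x\<close> over disjoint classes.\<close>
    also have "real (card (cl s)) * x $ r \<le> real (card (cl s)) * (\<Sum>k\<in>R - {r}. x $ k)"
      using le by (intro mult_left_mono) auto
    also have "\<dots> = (\<Sum>k\<in>R - {r}. real (card (cl s)) * x $ k)"
      by (rule sum_distrib_left)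
    also have "\<dots> \<le> (\<Sum>k\<in>R - {r}. real (card (cl k)) * x $ k)"
      using s_min nonneg R by (intro sum_mono mult_right_mono) auto
    also have "real (card (cl r)) * x $ r + (\<Sum>k\<in>R - {r}. real (card (cl k)) * x $ k)
        = (\<Sum>k\<in>R. real (card (cl k)) * x $ k)"
      using r R by (simp add: sum.remove)
    also have "\<dots> = (\<Sum>k\<in>R. \<Sum>i\<in>cl k. x $ i)"
      by (simp only: sum_cl)
    also have "\<dots> = (\<Sum>i\<in>(\<Union>k\<in>R. cl k). x $ i)"
      using R disj_R by (intro sum.UNION_disjoint [symmetric]) auto
    also have "\<dots> \<le> (\<Sum>i<n. x $ i)"
      using cl_sub nonneg by (intro sum_mono2) auto
    finally show ?thesis
      by (simp add: d_def n_def)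
  qed
qed

theorem proposition4p2:
  fixes m n :: nat and H :: "bit mat" and C :: "bit vec set"
  assumes "binary_linear_code n C"
    and "C \<noteq> {0\<^sub>v n}"
    and "m \<ge> 1"
    and "H \<in> carrier_mat m n"
    and "parity_check_matrix C H"
    and "\<forall>j < m - 1. card (row_support H j) = 2"
    and "\<forall>E \<in> {..<n} // column_rel (first_rows (m - 1) H). card (row_support H (m - 1) \<inter> E) \<le> 1"
  shows "is_min_pseudoweight w_AWGNC H (real (min_distance C)) \<and>
         is_min_pseudoweight w_BSC H (real (min_distance C)) \<and>
         is_min_pseudoweight w_maxfrac H (real (min_distance C))"
proof -
  have dims: "dim_row H = m" "dim_col H = n"
    using assms(4) by auto
  have C: "C = mat_kernel H"
    using assms(5) by (simp add: parity_check_matrix_def)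
  define d where "d = real (min_distance C)"
  have lower: "d \<le> w_maxfrac x \<and> w_maxfrac x \<le> w_AWGNC x \<and> w_maxfrac x \<le> w_BSC x"
    if x: "x \<in> fundamental_cone H - {0\<^sub>v (dim_col H)}" for x
  proof -
    have dim: "dim_vec x = n" and nonneg: "\<And>i. i < dim_vec x \<Longrightarrow> 0 \<le> x $ i"
      using x dims by (auto simp: fundamental_cone_def)
    have "\<exists>i<n. x $ i \<noteq> 0"
      using x dim dims by (auto simp: vec_eq_iff)
    then have pos: "0 < (\<Sum>i<dim_vec x. x $ i)"
      using nonneg dim by (metis finite_lessThan lessThan_iff order_le_less sum_pos2)
    define M where "M = Max ((\<lambda>i. x $ i) ` {..<dim_vec x})"
    have M: "0 < M"
      unfolding M_def by (rule Max_vec_pos[OF pos])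
    have "{..<dim_vec x} \<noteq> {}"
      using pos by auto
    then have "M \<in> (\<lambda>i. x $ i) ` {..<dim_vec x}"
      unfolding M_def by (intro Max_in) auto
    then obtain p where p: "p < n" "x $ p = M"
      using dim by auto
    have "d * M \<le> (\<Sum>i<dim_vec x. x $ i)"
      using min_distance_mult_le_sum[of H m x p] assms(3,6,7) x p M dims dim
      by (simp add: d_def C)
    then have "d \<le> w_maxfrac x"
      using M by (simp add: w_maxfrac_def pos_le_divide_eq flip: M_def)
    then show ?thesis
      using w_maxfrac_le_w_AWGNC[OF nonneg pos] w_maxfrac_le_w_BSC[OF nonneg pos] by simp
  qed
  \<comment> \<open>The support of a codeword of minimum weight: its real indicator attains the
    lower bound for all three weights at once.\<close>
  obtain E where E: "codeword_support H E" "E \<noteq> {}" "card E = min_distance C"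
    using min_distance_attained[of H] assms(2) C dims by metis
  have sub: "E \<subseteq> {..<n}"
    using E(1) dims by (simp add: codeword_support_def)
  let ?x = "indicator_vec n E :: real vec"
  obtain i where "i \<in> E" "i < n"
    using E(2) sub by auto
  then have "?x $ i \<noteq> 0\<^sub>v n $ i"
    by simp
  then have "?x \<noteq> 0\<^sub>v n"
    by metis
  then have "?x \<in> fundamental_cone H - {0\<^sub>v (dim_col H)}"
    using indicator_vec_mem_fundamental_cone[OF E(1)] dims by simp
  moreover have "d \<le> w_AWGNC x" "d \<le> w_BSC x" "d \<le> w_maxfrac x"
    if "x \<in> fundamental_cone H - {0\<^sub>v (dim_col H)}" for x
    using lower[OF that] by linarith+
  moreover have "w_AWGNC ?x = d" "w_BSC ?x = d" "w_maxfrac ?x = d"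
    using w_AWGNC_indicator_vec[OF sub] w_BSC_indicator_vec[OF sub E(2)]
      w_maxfrac_indicator_vec[OF sub E(2)] E(3) by (simp_all add: d_def)
  ultimately show ?thesis
    unfolding is_min_pseudoweight_def d_def[symmetric] by blast
qed

end
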